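(* For all integers $n\ge1$: (1) $\overline{\mathbf{SF}}_{n,n}(q)=1$ and $\mathbf{SF}_{n,n}(q)=q^{\sum_{i=1}^{n-1}F_i}$; (2) $\overline{\mathbf{SF}}_{n,n-1}(q)=\sum_{i=1}^{n-1}[F_i]_q$ and $\mathbf{SF}_{n,n-1}(q)=q^{\sum_{i=1}^{n-2}F_i}\sum_{i=1}^{n-1}[F_i]_q$; (3) $\overline{\mathbf{SF}}_{n,n-2}(q)=\sum_{i=1}^{n-2}[F_i]_q\left(\sum_{j=i}^{n-2}[F_j]_q\right)$ and $\mathbf{SF}_{n,n-2}(q)=q^{\sum_{i=1}^{n-3}F_i}\sum_{i=1}^{n-2}[F_i]_q\left(\sum_{j=i}^{n-2}[F_j]_q\right)$; (4) $\overline{\mathbf{SF}}_{n,1}(q)=1$ and $\mathbf{SF}_{n,1}(q)=1$; (5) $\overline{\mathbf{SF}}_{n,2}(q)=n-1$ and $\mathbf{SF}_{n,2}(q)=q(n-1)$; (6) $\overline{\mathbf{SF}}_{n,3}(q)=\frac{(1+q)^{n-1}-(q(n-1)+1)}{q^2}$ and $\mathbf{SF}_{n,3}(q)=(1+q)^{n-1}-(q(n-1)+1)$.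
   Context: Fibonacci numbers: $F_0=0$, $F_1=1$, $F_m=F_{m-1}+F_{m-2}$. For any integer $m$, $[m]_q=\frac{1-q^m}{1-q}$. For $k\ge0$ let $[x]_{\downarrow_{q,F,k}}=\prod_{i=0}^{k-1}[x-F_i]_q$ and $\overline{[x]}_{\downarrow_{q,F,k}}=\prod_{i=0}^{k-1}([x]_q-[F_i]_q)$ (empty product $=1$). For $n\ge0$, $\mathbf{SF}_{n,k}(q)$ and $\overline{\mathbf{SF}}_{n,k}(q)$ ($0\le k\le n$) are the unique rational functions of $q$ with $[x]_q^n=\sum_{k=0}^n\mathbf{SF}_{n,k}(q)[x]_{\downarrow_{q,F,k}}$ and $[x]_q^n=\sum_{k=0}^n\overline{\mathbf{SF}}_{n,k}(q)\overline{[x]}_{\downarrow_{q,F,k}}$ for all positive integers $x$; set $\mathbf{SF}_{n,k}(q)=\overline{\mathbf{SF}}_{n,k}(q)=0$ if $k<0$ or $k>n$. Empty sums are $0$. *)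

theory Defs
  imports
    "HOL-Computational_Algebra.Computational_Algebra"
    "HOL-Number_Theory.Fib"
begin

type_synonym ratfun = "rat poly fract"

definition q :: ratfun where
  "q = to_fract [:0, 1:]"

definition qint :: "int \<Rightarrow> ratfun" where
  "qint m = (1 - q powi m) / (1 - q)"

definition fib_falling :: "int \<Rightarrow> nat \<Rightarrow> ratfun" where
  "fib_falling x k = (\<Prod>i<k. qint (x - int (fib i)))"

definition fib_falling_bar :: "int \<Rightarrow> nat \<Rightarrow> ratfun" where
  "fib_falling_bar x k = (\<Prod>i<k. qint x - qint (int (fib i)))"

text \<open>
  The lower index ranges over the integers, with value \<open>0\<close> outside \<open>0 \<le> k \<le> n\<close>. The lemmas
  \<open>ex1_SF_coeffs\<close> and \<open>ex1_SF_bar_coeffs\<close> below show that the descriptions are proper.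
\<close>

definition is_SF_coeffs :: "nat \<Rightarrow> (int \<Rightarrow> ratfun) \<Rightarrow> bool" where
  "is_SF_coeffs n c \<longleftrightarrow>
     (\<forall>k. k < 0 \<or> k > int n \<longrightarrow> c k = 0) \<and>
     (\<forall>x\<ge>1. qint x ^ n = (\<Sum>k=0..n. c (int k) * fib_falling x k))"

definition is_SF_bar_coeffs :: "nat \<Rightarrow> (int \<Rightarrow> ratfun) \<Rightarrow> bool" where
  "is_SF_bar_coeffs n c \<longleftrightarrow>
     (\<forall>k. k < 0 \<or> k > int n \<longrightarrow> c k = 0) \<and>
     (\<forall>x\<ge>1. qint x ^ n = (\<Sum>k=0..n. c (int k) * fib_falling_bar x k))"

definition SF :: "nat \<Rightarrow> int \<Rightarrow> ratfun" where
  "SF n = (THE c. is_SF_coeffs n c)"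

definition SF_bar :: "nat \<Rightarrow> int \<Rightarrow> ratfun" where
  "SF_bar n = (THE c. is_SF_bar_coeffs n c)"


subsection \<open>Existence and uniqueness of the coefficients\<close>

lemma newton_basis_exists:
  fixes a :: "nat \<Rightarrow> 'a :: comm_ring_1"
  shows "\<exists>c. (\<forall>k>n. c k = 0) \<and> (\<forall>y. y ^ n = (\<Sum>k=0..n. c k * (\<Prod>i<k. y - a i)))"
proof (induction n)
  case 0
  show ?case by (rule exI[of _ "\<lambda>k. if k = 0 then 1 else 0"]) auto
next
  case (Suc n)
  then obtain c where c0: "\<forall>k>n. c k = 0"
    and c: "\<And>y. y ^ n = (\<Sum>k=0..n. c k * (\<Prod>i<k. y - a i))" by blast
  define d where "d k = (if k = 0 then 0 else c (k - 1)) + a k * c k" for k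
  have "y ^ Suc n = (\<Sum>k=0..Suc n. d k * (\<Prod>i<k. y - a i))" for y
  proof -
    let ?P = "\<lambda>k. (\<Prod>i<k. y - a i)"
    have "y ^ Suc n = (\<Sum>k=0..n. c k * ?P (Suc k) + a k * c k * ?P k)"
      by (simp add: c sum_distrib_left algebra_simps)
    also have "\<dots> = (\<Sum>k=0..n. c k * ?P (Suc k)) + (\<Sum>k=0..n. a k * c k * ?P k)"
      by (rule sum.distrib)
    also have "(\<Sum>k=0..n. c k * ?P (Suc k)) = (\<Sum>k=0..Suc n. (if k = 0 then 0 else c (k - 1)) * ?P k)"
      by (subst sum.atLeast0_atMost_Suc_shift) simp
    also have "(\<Sum>k=0..n. a k * c k * ?P k) = (\<Sum>k=0..Suc n. a k * c k * ?P k)"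
      using c0 by simp
    finally show ?thesis
      by (simp only: d_def distrib_right sum.distrib)
  qed
  moreover have "\<forall>k>Suc n. d k = 0" using c0 by (simp add: d_def)
  ultimately show ?case by blast
qed

lemma newton_basis_independent:
  fixes a :: "nat \<Rightarrow> 'a :: field"
  assumes "infinite Y" and "\<And>y. y \<in> Y \<Longrightarrow> (\<Sum>k=0..n. c k * (\<Prod>i<k. y - a i)) = 0"
    and "k \<le> n"
  shows "c k = 0"
proof -
  define b where "b k = (\<Prod>i<k. [:- a i, 1:])" for k
  have deg: "degree (b k) = k" for k
    unfolding b_def by (subst degree_prod_eq_sum_degree) auto
  have lead: "coeff (b k) k = 1" for k
    using lead_coeff_prod[of "\<lambda>i. [:- a i, 1:]" "{..<k}"] deg[of k] by (simp add: b_def)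
  define p where "p = (\<Sum>k=0..n. smult (c k) (b k))"
  have "poly p y = (\<Sum>k=0..n. c k * (\<Prod>i<k. y - a i))" for y
    by (simp add: p_def b_def poly_sum poly_prod)
  hence "Y \<subseteq> {y. poly p y = 0}" using assms(2) by auto
  hence p0: "p = 0"
    using assms(1) poly_roots_finite[of p] finite_subset by blast
  have ind: "(\<Sum>k=0..m. smult (c k) (b k)) = 0 \<Longrightarrow> \<forall>k\<le>m. c k = 0" for m
  proof (induction m)
    case 0
    thus ?case using lead[of 0] by (auto simp: b_def)
  next
    case (Suc m)
    have "coeff (\<Sum>k=0..m. smult (c k) (b k)) (Suc m) = 0"
      by (auto simp: coeff_sum deg intro!: sum.neutral coeff_eq_0)
    hence "c (Suc m) = coeff (\<Sum>k=0..Suc m. smult (c k) (b k)) (Suc m)"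
      by (simp add: lead)
    hence "c (Suc m) = 0" by (simp only: Suc.prems coeff_0)
    with Suc show ?case by (auto simp: le_Suc_eq)
  qed
  show ?thesis using ind[of n] p0 assms(3) by (auto simp: p_def)
qed

lemma q_power: "q ^ m = to_fract (monom 1 m)"
proof (induction m)
  case (Suc m)
  have "monom (1::rat) (Suc m) = [:0, 1:] * monom 1 m" by (simp add: monom_Suc)
  thus ?case using Suc by (simp only: power_Suc q_def to_fract_mult)
qed (simp add: q_def)

lemma q_power_eq_iff: "q ^ m = q ^ m' \<longleftrightarrow> m = m'"
  by (simp add: q_power monom_eq_iff')

lemma q_neq_0: "q \<noteq> 0"
  by (simp add: q_def)

lemma q_neq_1: "q \<noteq> 1"
  using q_power_eq_iff[of 1 0] by simp

lemma infinite_qint: "infinite (qint ` {1..})"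
proof -
  have "inj_on qint {1..}"
  proof (rule inj_onI)
    fix x y :: int assume "x \<in> {1..}" "y \<in> {1..}" "qint x = qint y"
    thus "x = y"
      using q_neq_1 q_power_eq_iff[of "nat x" "nat y"]
      by (auto simp: qint_def power_int_def)
  qed
  thus ?thesis using finite_imageD infinite_Ici by blast
qed

lemma fib_falling_conv_bar:
  "fib_falling x k = fib_falling_bar x k / q ^ (\<Sum>i<k. fib i)"
proof -
  have "qint (x - int m) = (qint x - qint (int m)) / q ^ m" for m
  proof -
    have "qint x - qint (int m) = (q ^ m - q powi x) / (1 - q)"
      by (simp add: qint_def flip: diff_divide_distrib)
    thus ?thesis
      using q_neq_0 by (simp add: qint_def power_int_diff diff_divide_distrib)
  qed
  thus ?thesis
    by (simp add: fib_falling_def fib_falling_bar_def prod_dividef power_sum)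
qed

lemma ex1_coeffs_aux:
  assumes d: "\<And>k. d k \<noteq> 0"
  shows "\<exists>!c. (\<forall>k. k < 0 \<or> k > int n \<longrightarrow> c k = 0) \<and>
     (\<forall>x\<ge>1. qint x ^ n = (\<Sum>k=0..n. c (int k) * (fib_falling_bar x k / d k)))"
    (is "\<exists>!c. ?Q c")
proof (rule ex_ex1I)
  obtain c where c: "\<forall>k>n. c k = 0"
      "\<And>y. y ^ n = (\<Sum>k=0..n. c k * (\<Prod>i<k. y - qint (int (fib i))))"
    using newton_basis_exists[of n "\<lambda>i. qint (int (fib i))"] by blast
  have "?Q (\<lambda>k. if k < 0 then 0 else c (nat k) * d (nat k))"
    using c d by (auto simp: fib_falling_bar_def)
  thus "\<exists>c. ?Q c" by (rule exI[of ?Q])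
next
  fix c c' assume *: "?Q c" "?Q c'"
  have "(c (int k) - c' (int k)) / d k = 0" if "k \<le> n" for k
  proof (rule newton_basis_independent[OF infinite_qint _ that])
    fix y assume "y \<in> qint ` {1..}"
    then obtain x where x: "x \<ge> 1" "y = qint x" by auto
    have "(\<Sum>k=0..n. c (int k) * (fib_falling_bar x k / d k)) =
          (\<Sum>k=0..n. c' (int k) * (fib_falling_bar x k / d k))"
      using *[THEN conjunct2, rule_format, OF x(1)] by simp
    thus "(\<Sum>k=0..n. (c (int k) - c' (int k)) / d k * (\<Prod>i<k. y - qint (int (fib i)))) = 0"
      by (simp add: x fib_falling_bar_def left_diff_distrib diff_divide_distrib sum_subtractf)
  qed
  hence eq: "c (int k) = c' (int k)" if "k \<le> n" for k using that d by simp
  show "c = c'"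
  proof
    fix k show "c k = c' k"
      using *[THEN conjunct1, rule_format, of k] eq[of "nat k"]
      by (cases "k < 0 \<or> k > int n") auto
  qed
qed

lemma ex1_SF_coeffs: "\<exists>!c. is_SF_coeffs n c"
  unfolding is_SF_coeffs_def fib_falling_conv_bar
  by (rule ex1_coeffs_aux) (simp add: q_neq_0)

lemma ex1_SF_bar_coeffs: "\<exists>!c. is_SF_bar_coeffs n c"
  using ex1_coeffs_aux[of "\<lambda>_. 1" n] by (simp add: is_SF_bar_coeffs_def)

end

theory Submission
  imports Defs
begin

text \<open>
  Multiplying the expansion of \<open>[x]\<^sup>n\<close> by \<open>[x] = ([x] - [F\<^sub>k]) + [F\<^sub>k]\<close> gives the Stirling-type recurrence
  \<open>SF_bar (n + 1) k = SF_bar n (k - 1) + [F\<^sub>k] * SF_bar n k\<close>, from which all the formulas for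
  \<open>SF_bar\<close> follow by induction on \<open>n\<close>. Since \<open>[x - m] = q\<^sup>-\<^sup>m ([x] - [m])\<close>, the two families
  differ by the factor \<open>q\<close> to the power \<open>F\<^sub>0 + \<dots> + F\<^sub>k\<^sub>-\<^sub>1\<close>.
\<close>

lemma is_SF_bar_coeffs_SF_bar: "is_SF_bar_coeffs n (SF_bar n)"
  unfolding SF_bar_def by (rule theI'[OF ex1_SF_bar_coeffs])

lemma SF_bar_eqI: "is_SF_bar_coeffs n c \<Longrightarrow> SF_bar n = c"
  unfolding SF_bar_def by (rule the1_equality[OF ex1_SF_bar_coeffs])

lemma SF_eqI: "is_SF_coeffs n c \<Longrightarrow> SF n = c"
  unfolding SF_def by (rule the1_equality[OF ex1_SF_coeffs])

lemma SF_bar_outside: "k < 0 \<or> k > int n \<Longrightarrow> SF_bar n k = 0"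
  using is_SF_bar_coeffs_SF_bar[of n] by (auto simp: is_SF_bar_coeffs_def)

lemma qint_power_SF_bar:
  "x \<ge> 1 \<Longrightarrow> qint x ^ n = (\<Sum>k=0..n. SF_bar n (int k) * fib_falling_bar x k)"
  using is_SF_bar_coeffs_SF_bar[of n] by (auto simp: is_SF_bar_coeffs_def)

text \<open>The power of \<open>q\<close> cancels the denominator in
  \<open>fib_falling_conv_bar\<close>, so the rescaled coefficients satisfy the expansion that
  determines \<open>SF n\<close> uniquely.\<close>

lemma SF_eq_SF_bar: "SF n k = q ^ (\<Sum>i<nat k. fib i) * SF_bar n k"
proof -
  have "SF n = (\<lambda>k. q ^ (\<Sum>i<nat k. fib i) * SF_bar n k)"
    by (rule SF_eqI)
      (auto simp: is_SF_coeffs_def SF_bar_outside qint_power_SF_bar fib_falling_conv_bar q_neq_0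
        intro!: sum.cong)
  thus ?thesis by simp
qed

lemma SF_bar_0: "SF_bar 0 k = (if k = 0 then 1 else 0)"
proof -
  have "SF_bar 0 = (\<lambda>k. if k = 0 then 1 else 0)"
    by (rule SF_bar_eqI) (auto simp: is_SF_bar_coeffs_def fib_falling_bar_def)
  thus ?thesis by simp
qed

lemma SF_bar_Suc:
  "SF_bar (Suc n) k = SF_bar n (k - 1) + qint (int (fib (nat k))) * SF_bar n k"
proof -
  define c where "c k = SF_bar n (k - 1) + qint (int (fib (nat k))) * SF_bar n k" for k
  have "qint x ^ Suc n = (\<Sum>k=0..Suc n. c (int k) * fib_falling_bar x k)" if x: "x \<ge> 1" for x
  proof -
    let ?P = "fib_falling_bar x" and ?a = "\<lambda>k. qint (int (fib k))"
    have "qint x ^ Suc n =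
        (\<Sum>k=0..n. SF_bar n (int k) * ?P (Suc k) + ?a k * SF_bar n (int k) * ?P k)"
      by (simp add: qint_power_SF_bar[OF x] sum_distrib_left fib_falling_bar_def algebra_simps)
    also have "\<dots> = (\<Sum>k=0..n. SF_bar n (int k) * ?P (Suc k)) +
        (\<Sum>k=0..n. ?a k * SF_bar n (int k) * ?P k)"
      by (rule sum.distrib)
    \<comment> \<open>The shift adds a term at \<open>k = 0\<close>, which vanishes because
      \<open>SF_bar n (-1) = 0\<close>; the term \<open>k = Suc n\<close> added in the next step
      vanishes likewise.\<close>
    also have "(\<Sum>k=0..n. SF_bar n (int k) * ?P (Suc k)) =
        (\<Sum>k=0..Suc n. SF_bar n (int k - 1) * ?P k)"
      by (subst sum.atLeast0_atMost_Suc_shift) (simp add: SF_bar_outside)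
    also have "(\<Sum>k=0..n. ?a k * SF_bar n (int k) * ?P k) =
        (\<Sum>k=0..Suc n. ?a k * SF_bar n (int k) * ?P k)"
      by (simp add: SF_bar_outside)
    finally show ?thesis
      by (simp only: c_def nat_int distrib_right sum.distrib)
  qed
  hence "is_SF_bar_coeffs (Suc n) c"
    by (auto simp: is_SF_bar_coeffs_def c_def SF_bar_outside)
  from SF_bar_eqI[OF this] show ?thesis by (simp add: c_def)
qed

text \<open>Keeping the index in the form \<open>int (Suc k)\<close> lets the inductions along
  diagonals rewrite with the recurrence.\<close>

lemma SF_bar_Suc_Suc:
  "SF_bar (Suc n) (int (Suc k)) =
    SF_bar n (int k) + qint (int (fib (Suc k))) * SF_bar n (int (Suc k))"
  using SF_bar_Suc[of n "int (Suc k)"] unfolding nat_int by simp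

lemma qint_0 [simp]: "qint 0 = 0"
  by (simp add: qint_def)

lemma qint_1 [simp]: "qint 1 = 1"
  using q_neq_1 by (simp add: qint_def)

lemma qint_2: "qint 2 = 1 + q"
proof -
  have "1 - q ^ 2 = (1 + q) * (1 - q)"
    by (simp add: power2_eq_square algebra_simps)
  thus ?thesis using q_neq_1 by (simp add: qint_def)
qed

lemma SF_bar_diag: "SF_bar n (int n) = 1"
  by (induction n) (simp_all add: SF_bar_0 SF_bar_Suc SF_bar_outside)

lemma SF_bar_diag1: "SF_bar (Suc n) (int n) = (\<Sum>i=1..n. qint (int (fib i)))"
proof (induction n)
  case (Suc n)
  show ?case
    unfolding SF_bar_Suc_Suc Suc SF_bar_diag by simp
qed (simp add: SF_bar_Suc SF_bar_outside)

text \<open>The double sum is the complete homogeneous symmetric polynomial h_2 in the variables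
  \<open>a 1\<close>, ..., \<open>a n\<close>. With one more variable, a monomial either avoids
  \<open>a (Suc n)\<close> or is \<open>a (Suc n)\<close> times some variable.\<close>

lemma sum_complete_homogeneous_Suc:
  fixes a :: "nat \<Rightarrow> 'a :: comm_semiring_1"
  shows "(\<Sum>i=1..Suc n. a i * (\<Sum>j=i..Suc n. a j)) =
    (\<Sum>i=1..n. a i * (\<Sum>j=i..n. a j)) + a (Suc n) * (\<Sum>i=1..Suc n. a i)"
proof -
  have "(\<Sum>i=1..n. a i * (\<Sum>j=i..Suc n. a j)) =
      (\<Sum>i=1..n. a i * (\<Sum>j=i..n. a j) + a (Suc n) * a i)"
    by (rule sum.cong) (auto simp: algebra_simps)
  thus ?thesis by (simp add: sum.distrib sum_distrib_left algebra_simps)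
qed

text \<open>With h_1 supplied by \<open>SF_bar_diag1\<close>, the recurrence along this diagonal is
  the one for h_2 in [F_1], ..., [F_n].\<close>

lemma SF_bar_diag2:
  "SF_bar (n + 2) (int n) = (\<Sum>i=1..n. qint (int (fib i)) * (\<Sum>j=i..n. qint (int (fib j))))"
proof (induction n)
  case (Suc n)
  have "SF_bar (Suc n + 2) (int (Suc n)) =
      SF_bar (n + 2) (int n) + qint (int (fib (Suc n))) * SF_bar (Suc (Suc n)) (int (Suc n))"
    using SF_bar_Suc_Suc[of "n + 2" n] by simp
  thus ?case
    by (simp only: Suc SF_bar_diag1 sum_complete_homogeneous_Suc)
qed (simp add: SF_bar_Suc SF_bar_outside numeral_2_eq_2)

lemma SF_bar_Suc_0: "SF_bar (Suc n) 0 = 0"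
  by (simp add: SF_bar_Suc SF_bar_outside)

lemma SF_bar_1: "SF_bar (Suc n) 1 = 1"
proof (induction n)
  case (Suc n)
  thus ?case using SF_bar_Suc[of "Suc n" 1] by (simp add: SF_bar_Suc_0)
qed (simp add: SF_bar_Suc SF_bar_0)

text \<open>Since \<open>fib 2 = 1\<close>, each new row adds an entry of column 1, which is
  1.\<close>

lemma SF_bar_2: "SF_bar (Suc n) 2 = of_nat n"
proof (induction n)
  case (Suc n)
  thus ?case using SF_bar_Suc[of "Suc n" 2] by (simp add: SF_bar_1)
qed (simp add: SF_bar_outside)

text \<open>The factor \<open>q ^ 2\<close> clears the denominator, so the induction step is a ring
  identity; \<open>fib 3 = 2\<close> makes the multiplier in the recurrence
  \<open>1 + q\<close>.\<close>

lemma SF_bar_3: "q ^ 2 * SF_bar (Suc n) 3 = (1 + q) ^ n - (q * of_nat n + 1)"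
proof (induction n)
  case (Suc n)
  have "fib 3 = 2" by (simp add: numeral_3_eq_3)
  hence "q ^ 2 * SF_bar (Suc (Suc n)) 3 = q ^ 2 * of_nat n + (1 + q) * (q ^ 2 * SF_bar (Suc n) 3)"
    using SF_bar_Suc[of "Suc n" 3] by (simp add: SF_bar_2 qint_2 algebra_simps)
  thus ?case unfolding Suc by (simp add: power2_eq_square algebra_simps)
qed (simp add: SF_bar_outside)

lemma sum_fib_lessThan: "(\<Sum>i<n. fib i) = (\<Sum>i=1..n-1. fib i)"
proof (cases n)
  case (Suc m)
  have "{..<n} = insert 0 {1..m}" using Suc by auto
  thus ?thesis using Suc by simp
qed simp

theorem theorem10:
  fixes n :: nat
  assumes "n \<ge> 1"
  shows
    "(SF_bar n (int n) = 1 \<and>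
      SF n (int n) = q ^ (\<Sum>i=1..n-1. fib i)) \<and>
     (SF_bar n (int n - 1) = (\<Sum>i=1..n-1. qint (int (fib i))) \<and>
      SF n (int n - 1) = q ^ (\<Sum>i=1..n-2. fib i) * (\<Sum>i=1..n-1. qint (int (fib i)))) \<and>
     (SF_bar n (int n - 2) =
        (\<Sum>i=1..n-2. qint (int (fib i)) * (\<Sum>j=i..n-2. qint (int (fib j)))) \<and>
      SF n (int n - 2) = q ^ (\<Sum>i=1..n-3. fib i) *
        (\<Sum>i=1..n-2. qint (int (fib i)) * (\<Sum>j=i..n-2. qint (int (fib j))))) \<and>
     (SF_bar n 1 = 1 \<and> SF n 1 = 1) \<and>
     (SF_bar n 2 = of_nat (n - 1) \<and> SF n 2 = q * of_nat (n - 1)) \<and>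
     (SF_bar n 3 = ((1 + q) ^ (n - 1) - (q * of_nat (n - 1) + 1)) / q ^ 2 \<and>
      SF n 3 = (1 + q) ^ (n - 1) - (q * of_nat (n - 1) + 1))"
proof -
  obtain m where n: "n = Suc m" using assms by (cases n) auto
  have diag2: "SF_bar n (int n - 2) =
      (\<Sum>i=1..n-2. qint (int (fib i)) * (\<Sum>j=i..n-2. qint (int (fib j))))"
  proof (cases m)
    \<comment> \<open>Here \<open>n = 1\<close>: the index is -1, outside the range, and truncated
      subtraction makes the sum empty.\<close>
    case 0
    thus ?thesis by (simp add: n SF_bar_outside)
  next
    case (Suc l)
    thus ?thesis using SF_bar_diag2[of l] by (simp add: n)
  qed
  have diag1: "SF_bar n (int n - 1) = (\<Sum>i=1..n-1. qint (int (fib i)))"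
    using SF_bar_diag1[of m] by (simp add: n)
  have low3: "q ^ 2 * SF_bar n 3 = (1 + q) ^ (n - 1) - (q * of_nat (n - 1) + 1)"
    using SF_bar_3[of m] by (simp add: n)
  have "SF n (int n) = q ^ (\<Sum>i=1..n-1. fib i)"
    by (simp add: SF_eq_SF_bar SF_bar_diag sum_fib_lessThan)
  moreover have "SF n (int n - 1) =
      q ^ (\<Sum>i=1..n-2. fib i) * (\<Sum>i=1..n-1. qint (int (fib i)))"
  proof -
    have "nat (int n - 1) = n - 1" "n - 1 - 1 = n - 2" by auto
    thus ?thesis by (simp only: SF_eq_SF_bar diag1 sum_fib_lessThan)
  qed
  moreover have "SF n (int n - 2) = q ^ (\<Sum>i=1..n-3. fib i) *
      (\<Sum>i=1..n-2. qint (int (fib i)) * (\<Sum>j=i..n-2. qint (int (fib j))))"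
  proof -
    \<comment> \<open>At \<open>n = 1\<close> both sides of the first equation are 0, by
      truncation.\<close>
    have "nat (int n - 2) = n - 2" "n - 2 - 1 = n - 3" by auto
    thus ?thesis by (simp only: SF_eq_SF_bar diag2 sum_fib_lessThan)
  qed
  moreover have "SF n 1 = 1" "SF n 2 = q * of_nat (n - 1)"
    by (simp_all add: n SF_eq_SF_bar SF_bar_1 SF_bar_2 numeral_2_eq_2)
  moreover have "SF n 3 = (1 + q) ^ (n - 1) - (q * of_nat (n - 1) + 1)"
  proof -
    \<comment> \<open>The exponent 0 + 1 + 1 is exactly the power of \<open>q\<close> in
      \<open>low3\<close>.\<close>
    have "(\<Sum>i<nat 3. fib i) = 2" by (simp add: numeral_3_eq_3)
    thus ?thesis by (simp only: SF_eq_SF_bar low3)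
  qed
  moreover have "SF_bar n 3 = ((1 + q) ^ (n - 1) - (q * of_nat (n - 1) + 1)) / q ^ 2"
    unfolding low3[symmetric] using q_neq_0 by simp
  moreover have "SF_bar n 1 = 1" "SF_bar n 2 = of_nat (n - 1)"
    by (simp_all add: n SF_bar_1 SF_bar_2)
  ultimately show ?thesis
    using SF_bar_diag[of n] diag1 diag2 by blast
qed

end
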